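(* Let $H$ be a real Hilbert space, let $c\in H$, $r>0$, let $C=\mathbb{B}(c,r)=\{x\in H:\|x-c\|\le r\}$, and let $P_C:H\to C$ be the metric projection onto $C$. The regular coderivative of $P_C$ at a point $\bar{x}\in H$ is given as follows. (i) If $\bar{x}$ is in the interior of $C$ (i.e. $\|\bar{x}-c\|<r$), then $\widehat{D}^\ast P_C(\bar{x})(y)=\{y\}$ for every $y\in H$. (ii) If $\bar{x}\in H\setminus C$, then $$\widehat{D}^\ast P_C(\bar{x})(y)=\left\{\frac{r}{\|\bar{x}-c\|}\Big(y-\frac{\langle \bar{x}-c,y\rangle}{\|\bar{x}-c\|^2}(\bar{x}-c)\Big)\right\}\quad\text{for every } y\in H.$$ (iii) If $\bar{x}$ is in the boundary of $C$ (i.e. $\|\bar{x}-c\|=r$), then for every $y\in H$ $$\widehat{D}^\ast P_C(\bar{x})(y)=\left\{z\in H:\ \langle y,\bar{x}-c\rangle\le\langle z,\bar{x}-c\rangle\le 0,\ \ y-z=\frac{\langle y-z,\bar{x}-c\rangle}{\|\bar{x}-c\|^2}(\bar{x}-c)\right\}.$$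
   Context: For a nonempty closed convex set $C\subset H$, $P_C(x)$ is the unique point $y\in C$ with $\|x-y\|=\inf_{w\in C}\|x-w\|$. For a nonempty subset $\Omega$ of a Hilbert space $K$ and $\bar{p}\in\Omega$, the (Fréchet) regular normal cone is $$\widehat{N}_\Omega(\bar{p})=\Big\{q\in K:\ \limsup_{p\to\bar{p},\ p\in\Omega}\frac{\langle q,p-\bar{p}\rangle}{\|p-\bar{p}\|}\le 0\Big\}$$ (limsup over $p\ne\bar p$), with $\widehat N_\Omega(\bar p)=\emptyset$ if $\bar p\notin\Omega$. $H\times H$ carries the inner product $\langle(x,y),(u,v)\rangle=\langle x,u\rangle+\langle y,v\rangle$ and the induced norm $\|(x,y)\|=\sqrt{\|x\|^2+\|y\|^2}$. For a single-valued mapping $f:H\to H$ with graph $\mathrm{gph}\,f=\{(x,f(x)):x\in H\}\subset H\times H$, the (Fréchet) regular coderivative of $f$ at $\bar{x}$ is the set-valued mapping $$\widehat{D}^\ast f(\bar{x})(w)=\{v\in H:\ (v,-w)\in\widehat{N}_{\mathrm{gph}\,f}(\bar{x},f(\bar{x}))\},\quad w\in H.$$ *)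

theory Defs
  imports "HOL-Analysis.Analysis"
begin

(* The library's closest_point requires a heine_borel (hence finite-dimensional) space. *)
definition metric_projection :: "'a::real_inner set \<Rightarrow> 'a \<Rightarrow> 'a" where
  "metric_projection C x = (THE y. y \<in> C \<and> norm (x - y) = (INF w\<in>C. norm (x - w)))"

(* The limsup is taken in the extended reals. The filter "at p within S" excludes p itself; if p is
   an isolated point of S the filter is bot, the limsup is -\<infinity>, and the cone is the whole space. *)
definition regular_normal_cone :: "'a::real_inner set \<Rightarrow> 'a \<Rightarrow> 'a set" where
  "regular_normal_cone S p =
     (if p \<in> S
      then {q. Limsup (at p within S) (\<lambda>u. ereal (inner q (u - p) / norm (u - p))) \<le> 0}
      else {})"

definition fun_graph :: "('a \<Rightarrow> 'b) \<Rightarrow> ('a \<times> 'b) set" where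
  "fun_graph f = {(x, f x) | x. True}"

(* The product type carries the inner product inner (x, y) (u, v) = inner x u + inner y v. *)
definition regular_coderivative :: "('a::real_inner \<Rightarrow> 'a) \<Rightarrow> 'a \<Rightarrow> 'a \<Rightarrow> 'a set" where
  "regular_coderivative f x w = {v. (v, - w) \<in> regular_normal_cone (fun_graph f) (x, f x)}"

end

theory Submission
  imports Defs
begin

text \<open>
  If \<open>f (x + h) = f x + \<phi> h + o(norm h)\<close> with \<open>\<phi>\<close> positively homogeneous, then testing the normal cone
  inequality along rays shows that \<open>v\<close> lies in the regular coderivative of \<open>f\<close> at \<open>x\<close> in direction
  \<open>w\<close> iff \<open>inner v h \<le> inner w (\<phi> h)\<close> for all \<open>h\<close>. If \<open>\<phi>\<close> is linear and self-adjoint, this means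
  \<open>v = \<phi> w\<close>. The projection onto the ball has such an expansion everywhere: with \<open>n = x - c\<close>,
  \<open>\<phi>\<close> is the identity inside, \<open>r / norm n\<close> times the projection onto the orthogonal complement of
  \<open>n\<close> outside, and on the sphere the projection onto the half-space \<open>{h. inner n h \<le> 0}\<close>.
\<close>

section \<open>Limits along a graph and the coderivative as an increment condition\<close>

text \<open>Both \<open>\<lambda>u. (u, f u)\<close> and its inverse \<open>fst\<close> on the graph
  preserve the punctured filters: the former by continuity at \<open>x\<close>, the latter because
  graph points sharing a first coordinate coincide.\<close>

lemma eventually_at_graph_iff:
  fixes f :: "'a::t2_space \<Rightarrow> 'b::topological_space"
  assumes "isCont f x"
  shows "(\<forall>\<^sub>F p in at (x, f x) within fun_graph f. Q p) \<longleftrightarrow> (\<forall>\<^sub>F u in at x. Q (u, f u))"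
proof
  have "filterlim (\<lambda>u. (u, f u)) (at (x, f x) within fun_graph f) (at x)"
    using assms unfolding filterlim_at isCont_def
    by (auto simp: fun_graph_def eventually_at_filter intro!: tendsto_Pair)
  then show "\<forall>\<^sub>F u in at x. Q (u, f u)" if "\<forall>\<^sub>F p in at (x, f x) within fun_graph f. Q p"
    using that by (rule eventually_compose_filterlim[rotated])
next
  assume Q: "\<forall>\<^sub>F u in at x. Q (u, f u)"
  have "filterlim fst (at x) (at (x, f x) within fun_graph f)"
    unfolding filterlim_at
  proof
    have "(fst \<longlongrightarrow> fst (x, f x)) (at (x, f x) within fun_graph f)"
      by (intro tendsto_fst tendsto_ident_at)
    then show "(fst \<longlongrightarrow> x) (at (x, f x) within fun_graph f)" by simp
  qed (auto simp: fun_graph_def eventually_at_filter intro!: always_eventually)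
  with Q have "\<forall>\<^sub>F p in at (x, f x) within fun_graph f. Q (fst p, f (fst p))"
    by (rule eventually_compose_filterlim)
  moreover have "\<forall>\<^sub>F p in at (x, f x) within fun_graph f. p \<in> fun_graph f"
    by (simp add: eventually_at_filter)
  ultimately show "\<forall>\<^sub>F p in at (x, f x) within fun_graph f. Q p"
    by eventually_elim (auto simp: fun_graph_def)
qed

lemma mem_regular_coderivative_iff:
  fixes f :: "'a::real_inner \<Rightarrow> 'a"
  assumes "isCont f x"
  shows "v \<in> regular_coderivative f x w \<longleftrightarrow>
    (\<forall>\<epsilon>>0. \<forall>\<^sub>F h in at 0.
      (inner v h - inner w (f (x + h) - f x)) / norm (h, f (x + h) - f x) < \<epsilon>)"
proof -
  have "v \<in> regular_coderivative f x w \<longleftrightarrow>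
    (\<forall>y>0. \<forall>\<^sub>F p in at (x, f x) within fun_graph f.
      ereal (inner (v, - w) (p - (x, f x)) / norm (p - (x, f x))) < y)"
    by (auto simp: regular_coderivative_def regular_normal_cone_def Limsup_le_iff fun_graph_def)
  also have "\<dots> \<longleftrightarrow> (\<forall>y>0. \<forall>\<^sub>F u in at x.
      ereal ((inner v (u - x) - inner w (f u - f x)) / norm (u - x, f u - f x)) < y)"
    by (simp add: eventually_at_graph_iff[OF assms])
  also have "\<dots> \<longleftrightarrow> (\<forall>\<epsilon>>0. \<forall>\<^sub>F u in at x.
      (inner v (u - x) - inner w (f u - f x)) / norm (u - x, f u - f x) < \<epsilon>)"
    (is "(\<forall>y>0. ?P y) \<longleftrightarrow> (\<forall>\<epsilon>>0. ?Q \<epsilon>)")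
  proof (intro iffI allI impI)
    fix \<epsilon> :: real assume *: "\<forall>y>0. ?P y" and "\<epsilon> > 0"
    then show "?Q \<epsilon>" using *[rule_format, of "ereal \<epsilon>"] by simp
  next
    \<comment> \<open>A threshold \<open>y\<close>, possibly infinite, is replaced by a real number
      strictly between 0 and \<open>y\<close>.\<close>
    fix y :: ereal assume *: "\<forall>\<epsilon>>0. ?Q \<epsilon>" and "y > 0"
    then obtain \<epsilon> where "\<epsilon> > 0" "ereal \<epsilon> < y"
      using ereal_dense2[of 0 y] by auto
    then show "?P y"
      using *[rule_format, of \<epsilon>] by (auto elim!: eventually_mono intro: less_trans[of _ "ereal \<epsilon>"])
  qed
  finally show ?thesis
    unfolding eventually_at_to_0[of _ x] by (simp add: add.commute)
qed

section \<open>Coderivatives from first-order expansions\<close>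

text \<open>Asking only for positive homogeneity of \<open>\<phi>\<close> covers the sphere, where
  the projection has a kink. For sufficiency, the remainder enters the numerator with size at most
  \<open>norm w * norm (\<rho> h)\<close>, which is o(\<open>norm h\<close>), while the denominator
  is at least \<open>norm h\<close>.\<close>

lemma regular_coderivative_B_differentiable:
  fixes f \<phi> :: "'a::real_inner \<Rightarrow> 'a"
  assumes hom: "\<And>t h. t > 0 \<Longrightarrow> \<phi> (t *\<^sub>R h) = t *\<^sub>R \<phi> h"
    and cont: "(\<phi> \<longlongrightarrow> 0) (at 0)"
    and rem: "((\<lambda>h. norm (f (x + h) - f x - \<phi> h) / norm h) \<longlongrightarrow> 0) (at 0)"
  shows "regular_coderivative f x w = {v. \<forall>h. inner v h \<le> inner w (\<phi> h)}"
proof -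
  define \<rho> where "\<rho> h = f (x + h) - f x - \<phi> h" for h
  have rem': "((\<lambda>h. norm (\<rho> h) / norm h) \<longlongrightarrow> 0) (at 0)"
    using rem by (simp add: \<rho>_def)
  \<comment> \<open>Since \<open>\<rho>\<close> and \<open>\<phi>\<close> both tend to 0,
    \<open>f\<close> is continuous at \<open>x\<close>, as the parametrisation of the graph
    requires.\<close>
  have "((\<lambda>h. norm (\<rho> h) / norm h * norm h) \<longlongrightarrow> 0 * norm (0::'a)) (at 0)"
    by (intro tendsto_mult rem' tendsto_norm tendsto_ident_at)
  moreover have "\<forall>\<^sub>F h in at 0. norm (\<rho> h) / norm h * norm h = norm (\<rho> h)"
    by (auto simp: eventually_at_filter intro!: always_eventually)
  ultimately have "((\<lambda>h. norm (\<rho> h)) \<longlongrightarrow> 0) (at 0)"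
    using Lim_transform_eventually by fastforce
  then have "((\<lambda>h. \<rho> h + \<phi> h) \<longlongrightarrow> 0 + 0) (at 0)"
    by (intro tendsto_add[OF tendsto_norm_zero_cancel cont])
  then have "((\<lambda>h. f (x + h) - f x) \<longlongrightarrow> 0) (at 0)"
    by (simp add: \<rho>_def)
  then have isCont: "isCont f x"
    unfolding isCont_iff by (rule LIM_zero_cancel)
  have split: "f (x + h) - f x = \<phi> h + \<rho> h" for h
    by (simp add: \<rho>_def)
  have iff: "v \<in> regular_coderivative f x w \<longleftrightarrow> (\<forall>\<epsilon>>0. \<forall>\<^sub>F h in at 0.
      (inner v h - inner w (\<phi> h + \<rho> h)) / norm (h, \<phi> h + \<rho> h) < \<epsilon>)" for v
    unfolding mem_regular_coderivative_iff[OF isCont] split ..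
  show ?thesis
  proof (intro set_eqI iffI)
    fix v assume v: "v \<in> {v. \<forall>h. inner v h \<le> inner w (\<phi> h)}"
    show "v \<in> regular_coderivative f x w"
      unfolding iff
    proof (intro allI impI)
      fix \<epsilon> :: real assume "\<epsilon> > 0"
      have "((\<lambda>h. norm w * (norm (\<rho> h) / norm h)) \<longlongrightarrow> norm w * 0) (at 0)"
        by (intro tendsto_intros rem')
      then have "\<forall>\<^sub>F h in at 0. norm w * (norm (\<rho> h) / norm h) < \<epsilon>"
        using \<open>\<epsilon> > 0\<close> by (simp add: order_tendstoD(2))
      moreover have "\<forall>\<^sub>F h in at (0::'a). h \<noteq> 0"
        by (simp add: eventually_at_filter)
      ultimately show "\<forall>\<^sub>F h in at 0.
          (inner v h - inner w (\<phi> h + \<rho> h)) / norm (h, \<phi> h + \<rho> h) < \<epsilon>"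
      proof eventually_elim
        case (elim h)
        have "- inner w (\<rho> h) \<le> norm w * norm (\<rho> h)"
          using Cauchy_Schwarz_ineq2[of w "\<rho> h"] by linarith
        then have "inner v h - inner w (\<phi> h + \<rho> h) \<le> norm w * norm (\<rho> h)"
          using v by (auto simp: inner_add_right dest: spec[of _ h])
        also have "\<dots> < \<epsilon> * norm h"
          using elim by (simp add: field_simps)
        also have "\<dots> \<le> \<epsilon> * norm (h, \<phi> h + \<rho> h)"
          using \<open>\<epsilon> > 0\<close> by (simp add: norm_Pair real_le_rsqrt)
        finally show ?case
          using elim by (simp add: divide_less_eq norm_Pair add_pos_nonneg)
      qed
    qed
  next
    fix v assume v: "v \<in> regular_coderivative f x w"
    have nonzero: "inner v h \<le> inner w (\<phi> h)" if "h \<noteq> 0" for h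
    proof -
      \<comment> \<open>Only \<open>t > 0\<close> is used, matching the positive homogeneity of
        \<open>\<phi>\<close>.\<close>
      have lim: "filterlim (\<lambda>t. t *\<^sub>R h) (at 0) (at_right (0::real))"
        unfolding filterlim_at using that
        by (auto simp: eventually_at_filter intro!: tendsto_eq_intros)
      have "((\<lambda>t. norm (\<rho> (t *\<^sub>R h)) / norm (t *\<^sub>R h) * norm h) \<longlongrightarrow> 0 * norm h) (at_right 0)"
        by (intro tendsto_intros filterlim_compose[OF rem' lim])
      moreover have "\<forall>\<^sub>F t in at_right 0.
          norm (\<rho> (t *\<^sub>R h)) / norm (t *\<^sub>R h) * norm h = norm ((1 / t) *\<^sub>R \<rho> (t *\<^sub>R h))"
        using that by (auto simp: eventually_at_filter)
      ultimately have "((\<lambda>t. norm ((1 / t) *\<^sub>R \<rho> (t *\<^sub>R h))) \<longlongrightarrow> 0) (at_right 0)"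
        by (auto intro: Lim_transform_eventually)
      then have \<rho>0: "((\<lambda>t. (1 / t) *\<^sub>R \<rho> (t *\<^sub>R h)) \<longlongrightarrow> 0) (at_right 0)"
        by (rule tendsto_norm_zero_cancel)
      \<comment> \<open>\<open>g t\<close> is the quotient at the point \<open>t\<close> times
        \<open>h\<close>, with the factor \<open>t\<close> cancelled from numerator and denominator.
        Its limit \<open>l\<close> has the sign of
        \<open>inner v h - inner w (\<phi> h)\<close>.\<close>
      define g where "g t = (inner v h - inner w (\<phi> h + (1 / t) *\<^sub>R \<rho> (t *\<^sub>R h))) /
        norm (h, \<phi> h + (1 / t) *\<^sub>R \<rho> (t *\<^sub>R h))" for t
      define l where "l = (inner v h - inner w (\<phi> h + 0)) / norm (h, \<phi> h + 0)"
      have g: "(g \<longlongrightarrow> l) (at_right 0)"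
        unfolding g_def l_def using that by (intro tendsto_intros \<rho>0) (auto simp: norm_Pair)
      have "l \<le> \<epsilon>" if "\<epsilon> > 0" for \<epsilon>
      proof -
        have "\<forall>\<^sub>F k in at 0. (inner v k - inner w (\<phi> k + \<rho> k)) / norm (k, \<phi> k + \<rho> k) < \<epsilon>"
          using v that unfolding iff by blast
        then have "\<forall>\<^sub>F t in at_right 0.
            (inner v (t *\<^sub>R h) - inner w (\<phi> (t *\<^sub>R h) + \<rho> (t *\<^sub>R h))) /
            norm (t *\<^sub>R h, \<phi> (t *\<^sub>R h) + \<rho> (t *\<^sub>R h)) < \<epsilon>"
          using lim by (rule eventually_compose_filterlim)
        moreover have "\<forall>\<^sub>F t in at_right (0::real). t > 0"
          by (simp add: eventually_at_filter)
        ultimately have "\<forall>\<^sub>F t in at_right 0. g t \<le> \<epsilon>"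
        proof eventually_elim
          case (elim t)
          define k where "k = \<phi> h + (1 / t) *\<^sub>R \<rho> (t *\<^sub>R h)"
          have "\<phi> (t *\<^sub>R h) + \<rho> (t *\<^sub>R h) = t *\<^sub>R k"
            using elim by (simp add: hom k_def scaleR_add_right)
          moreover have "norm (t *\<^sub>R h, t *\<^sub>R k) = t * norm (h, k)"
            using elim by (simp flip: scaleR_Pair)
          ultimately have "g t = (inner v (t *\<^sub>R h) - inner w (\<phi> (t *\<^sub>R h) + \<rho> (t *\<^sub>R h))) /
            norm (t *\<^sub>R h, \<phi> (t *\<^sub>R h) + \<rho> (t *\<^sub>R h))"
            using elim by (simp add: g_def flip: k_def right_diff_distrib)
          then show ?case using elim by simp
        qed
        then show ?thesis
          using g by (intro tendsto_upperbound[of g l]) auto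
      qed
      then have "l \<le> 0"
        by (rule field_le_epsilon[of l 0, simplified])
      moreover have "norm (h, \<phi> h) > 0"
        using that by (simp add: zero_prod_def)
      ultimately show ?thesis
        by (simp add: l_def divide_le_0_iff)
    qed
    \<comment> \<open>The ray through \<open>h = 0\<close> is degenerate, so this case is separate:
      homogeneity with factor 2 gives \<open>\<phi> 0\<close> equal to its own double.\<close>
    have "\<phi> 0 = 0"
      using hom[of 2 0] by (simp add: scaleR_2)
    then have "inner v h \<le> inner w (\<phi> h)" for h
      using nonzero[of h] by (cases "h = 0") auto
    then show "v \<in> {v. \<forall>h. inner v h \<le> inner w (\<phi> h)}"
      by blast
  qed
qed

lemma regular_coderivative_has_derivative:
  fixes f :: "'a::real_inner \<Rightarrow> 'a"
  assumes f: "(f has_derivative D) (at x)"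
    and adj: "\<And>h k. inner (D h) k = inner h (D k)"
  shows "regular_coderivative f x w = {D w}"
proof -
  interpret D: bounded_linear D
    using f by (rule has_derivative_bounded_linear)
  have "(D \<longlongrightarrow> D 0) (at 0)"
    using D.isCont unfolding isCont_def by blast
  then have "regular_coderivative f x w = {v. \<forall>h. inner v h \<le> inner w (D h)}"
    using f by (intro regular_coderivative_B_differentiable)
      (auto simp: D.scaleR D.zero has_derivative_at)
  also have "\<dots> = {D w}"
  proof (intro set_eqI iffI)
    fix v assume "v \<in> {v. \<forall>h. inner v h \<le> inner w (D h)}"
    \<comment> \<open>Test with \<open>h = v - D w\<close> and move \<open>D\<close> onto
      \<open>w\<close> by self-adjointness.\<close>
    then have "inner (v - D w) (v - D w) \<le> 0"
      by (simp add: inner_diff_left adj)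
    then show "v \<in> {D w}"
      by (metis eq_iff_diff_eq_0 inner_eq_zero_iff inner_ge_zero order_antisym singleton_iff)
  qed (simp add: adj)
  finally show ?thesis .
qed

section \<open>The projection onto a ball in closed form\<close>

text \<open>For \<open>u = c\<close> the junk value \<open>r / 0 = 0\<close> is harmless, since it is multiplied by \<open>u - c = 0\<close>.\<close>
lemma metric_projection_cball:
  fixes c u :: "'a::real_inner"
  assumes "r > 0"
  shows "metric_projection (cball c r) u = u - max 0 (1 - r / norm (u - c)) *\<^sub>R (u - c)"
    (is "_ = ?p")
proof -
  \<comment> \<open>The distance from \<open>u\<close> to the ball; \<open>?p\<close> attains it,
    and the triangle inequality through \<open>c\<close> shows that no point of the ball is
    closer.\<close>
  let ?d = "max 0 (norm (u - c) - r)"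
  have mem: "?p \<in> cball c r" and dist: "norm (u - ?p) = ?d"
  proof -
    consider "u = c" | "u \<noteq> c" "norm (u - c) \<le> r" | "u \<noteq> c" "norm (u - c) > r" by linarith
    then have "?p \<in> cball c r \<and> norm (u - ?p) = ?d"
    proof cases
      case 3
      then have "max 0 (1 - r / norm (u - c)) = 1 - r / norm (u - c)"
        using assms by (simp add: field_simps)
      moreover from this have "?p = c + (r / norm (u - c)) *\<^sub>R (u - c)"
        by (simp add: scaleR_diff_left)
      moreover have "\<bar>1 - r / norm (u - c)\<bar> * norm (u - c) = norm (u - c) - r"
        using 3 assms by (subst abs_of_nonneg) (auto simp: field_simps)
      moreover have "norm (u - ?p) = \<bar>max 0 (1 - r / norm (u - c))\<bar> * norm (u - c)"
        by simp
      ultimately show ?thesis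
        using 3 assms by (simp add: dist_norm)
    qed (use assms in \<open>auto simp: dist_norm norm_minus_commute max_def field_simps\<close>)
    then show "?p \<in> cball c r" "norm (u - ?p) = ?d" by auto
  qed
  have lower: "?d \<le> norm (u - y)" if "y \<in> cball c r" for y
    using that norm_triangle_ineq[of "u - y" "y - c"] by (simp add: dist_norm norm_minus_commute)
  have inf: "(INF y\<in>cball c r. norm (u - y)) = ?d"
    using mem dist lower by (intro cInf_eq_minimum) (auto intro: rev_image_eqI)
  have unique: "y = ?p" if y: "y \<in> cball c r" "norm (u - y) = ?d" for y
  proof (cases "norm (u - c) \<le> r")
    case True
    then show ?thesis using y dist by simp
  next
    case False
    define s where "s = norm (u - c)"
    have "s > r" "norm (u - y) = s - r" "norm (y - c) \<le> r"
      using False y by (auto simp: s_def dist_norm norm_minus_commute)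
    moreover have "s \<le> norm (u - y) + norm (y - c)"
      using norm_triangle_ineq[of "u - y" "y - c"] by (simp add: s_def)
    ultimately have s: "s > r" "norm (u - y) = s - r" "norm (y - c) = r" by auto
    \<comment> \<open>The triangle inequality through \<open>y\<close> is now an equality, so
      \<open>u - y\<close> and \<open>y - c\<close> point in the same direction, which pins
      \<open>y\<close> to the ray from \<open>c\<close> through \<open>u\<close>.\<close>
    then have "(s - r) *\<^sub>R (y - c) = r *\<^sub>R (u - y)"
      using norm_triangle_eq[of "u - y" "y - c"] by (simp add: s_def)
    then have "s *\<^sub>R (y - c) = r *\<^sub>R (u - c)"
      by (simp add: algebra_simps)
    then have "y - c = (r / s) *\<^sub>R (u - c)"
      using s assms by (metis less_trans less_irrefl vector_fraction_eq_iff)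
    moreover have "max 0 (1 - r / s) = 1 - r / s"
      using s assms by (simp add: field_simps)
    ultimately show ?thesis
      by (simp add: s_def algebra_simps)
  qed
  show ?thesis
    unfolding metric_projection_def inf
    by (rule the_equality) (use mem dist unique in blast)+
qed

section \<open>First-order behaviour of the projection and the resulting inequality\<close>

text \<open>This is the shrink factor of the projection before truncation by \<open>max 0\<close>,
  needed both outside the ball and on the sphere. The cube joins a square from the reciprocal with
  one power from the derivative of the norm.\<close>

lemma has_derivative_one_minus_radius_div_norm:
  fixes c x :: "'a::real_inner"
  assumes "x \<noteq> c"
  shows "((\<lambda>u. 1 - r / norm (u - c)) has_derivative
    (\<lambda>h. r * inner (x - c) h / norm (x - c) ^ 3)) (at x)"
proof -
  have "(norm has_derivative (\<lambda>h. inner h (sgn (x - c)))) (at (x - c))"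
    using assms by (intro has_derivative_norm) simp
  then have "((\<lambda>u. norm (u - c)) has_derivative (\<lambda>h. inner h (sgn (x - c)))) (at x)"
    by (rule has_derivative_compose[rotated]) (auto intro!: derivative_eq_intros)
  moreover have "inner h (sgn (x - c)) = inner (x - c) h / norm (x - c)" for h
    by (simp add: sgn_div_norm inner_commute divide_inverse mult.commute)
  ultimately have "((\<lambda>u. norm (u - c)) has_derivative (\<lambda>h. inner (x - c) h / norm (x - c))) (at x)"
    by simp
  note this[derivative_intros]
  show ?thesis
    by (rule derivative_eq_intros refl)+
      (use assms in \<open>auto simp: power3_eq_cube mult.assoc\<close>)
qed

text \<open>The shrink factor \<open>\<alpha>\<close> vanishes at \<open>x\<close>, and
  \<open>max 0\<close> is 1-Lipschitz, so \<open>max 0 (\<alpha> (x + h))\<close> may be replaced by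
  \<open>max 0 (D h)\<close> up to o(\<open>norm h\<close>).\<close>

lemma B_derivative_metric_projection_cball_boundary:
  fixes c x :: "'a::real_inner"
  assumes "r > 0" and x: "norm (x - c) = r"
  defines "P \<equiv> metric_projection (cball c r)"
  shows "((\<lambda>h. norm (P (x + h) - P x -
    (h - max 0 (inner (x - c) h / (norm (x - c))\<^sup>2) *\<^sub>R (x - c))) / norm h) \<longlongrightarrow> 0) (at 0)"
proof -
  define \<alpha> where "\<alpha> u = 1 - r / norm (u - c)" for u
  define D where "D h = inner (x - c) h / (norm (x - c))\<^sup>2" for h
  have "x \<noteq> c" using assms by auto
  have [simp]: "\<alpha> x = 0"
    using assms by (simp add: \<alpha>_def)
  have der: "(\<alpha> has_derivative D) (at x)"
    using has_derivative_one_minus_radius_div_norm[OF \<open>x \<noteq> c\<close>, of r] assms(1)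
    unfolding \<alpha>_def D_def x by (simp add: power2_eq_square power3_eq_cube)
  then have lim: "((\<lambda>h. \<bar>\<alpha> (x + h) - D h\<bar> / norm h) \<longlongrightarrow> 0) (at 0)"
    by (simp add: has_derivative_at)
  have "isCont \<alpha> x"
    using der by (rule has_derivative_continuous)
  then have "((\<lambda>h. \<alpha> (x + h)) \<longlongrightarrow> 0) (at 0)"
    by (simp add: isCont_iff)
  from tendsto_add[OF tendsto_mult_left_zero[OF lim] tendsto_rabs_zero[OF this]]
  have bound: "((\<lambda>h. \<bar>\<alpha> (x + h) - D h\<bar> / norm h * r + \<bar>\<alpha> (x + h)\<bar>) \<longlongrightarrow> 0) (at 0)"
    by simp
  show ?thesis
  proof (rule Lim_null_comparison[OF _ bound])
    have "norm (norm (P (x + h) - P x - (h - max 0 (D h) *\<^sub>R (x - c))) / norm h)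
      \<le> \<bar>\<alpha> (x + h) - D h\<bar> / norm h * r + \<bar>\<alpha> (x + h)\<bar>" if "h \<noteq> 0" for h
    proof -
      have P: "P u = u - max 0 (\<alpha> u) *\<^sub>R (u - c)" for u
        using assms(1) by (simp add: P_def \<alpha>_def metric_projection_cball)
      \<comment> \<open>Here \<open>P x = x\<close>, and \<open>x + h - c\<close> is split into
        \<open>x - c\<close> and \<open>h\<close>. The first error term comes from linearising
        \<open>\<alpha>\<close>; the second is \<open>h\<close> times a factor tending to 0.\<close>
      have "P (x + h) - P x - (h - max 0 (D h) *\<^sub>R (x - c)) =
        (max 0 (D h) - max 0 (\<alpha> (x + h))) *\<^sub>R (x - c) - max 0 (\<alpha> (x + h)) *\<^sub>R h"
        by (simp add: P algebra_simps)
      also have "norm \<dots> \<le> \<bar>max 0 (D h) - max 0 (\<alpha> (x + h))\<bar> * r + \<bar>max 0 (\<alpha> (x + h))\<bar> * norm h"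
        by (rule order_trans[OF norm_triangle_ineq4]) (simp add: x)
      also have "\<dots> \<le> \<bar>\<alpha> (x + h) - D h\<bar> * r + \<bar>\<alpha> (x + h)\<bar> * norm h"
        using assms(1) by (intro add_mono mult_right_mono) auto
      finally show ?thesis
        using that by (simp add: field_simps)
    qed
    then show "\<forall>\<^sub>F h in at 0. norm (norm (P (x + h) - P x -
        (h - max 0 (inner (x - c) h / (norm (x - c))\<^sup>2) *\<^sub>R (x - c))) / norm h)
      \<le> \<bar>\<alpha> (x + h) - D h\<bar> / norm h * r + \<bar>\<alpha> (x + h)\<bar>"
      unfolding D_def by (auto simp: eventually_at_filter)
  qed
qed

text \<open>The left side says \<open>max 0 t * inner y n \<le> inner (y - z) h\<close>, with
  \<open>t\<close> the coordinate of \<open>h\<close> along \<open>n\<close>. Testing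
  \<open>- n\<close>, which the half-space projection fixes, and \<open>n\<close>, which it sends to
  0, yields the two inequalities.\<close>

lemma polar_of_halfspace_projection_iff:
  fixes n y z :: "'a::real_inner"
  assumes "n \<noteq> 0"
  shows "(\<forall>h. inner z h \<le> inner y (h - max 0 (inner n h / (norm n)\<^sup>2) *\<^sub>R n)) \<longleftrightarrow>
    inner y n \<le> inner z n \<and> inner z n \<le> 0 \<and>
    y - z = (inner (y - z) n / (norm n)\<^sup>2) *\<^sub>R n"
    (is "?L \<longleftrightarrow> ?R")
proof
  have nn: "inner n n = (norm n)\<^sup>2" "norm n > 0"
    using assms by (auto simp: power2_norm_eq_inner)
  {
    assume L: ?L
    have "inner y n \<le> inner z n"
      using L[rule_format, of "- n"] nn by (simp add: max_def divide_le_0_iff)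
    moreover have "inner z n \<le> 0"
      using L[rule_format, of n] nn by simp
    moreover
    \<comment> \<open>The component of \<open>y - z\<close> orthogonal to \<open>n\<close>. The
      half-space projection fixes \<open>- d\<close>, so the test there bounds the squared norm of
      \<open>d\<close> by 0.\<close>
    define d where "d = (y - z) - (inner (y - z) n / (norm n)\<^sup>2) *\<^sub>R n"
    have dn: "inner n d = 0"
      using nn by (simp add: d_def inner_diff_right inner_commute)
    then have "inner (y - z) d \<le> 0"
      using L[rule_format, of "- d"] by (simp add: inner_diff_left)
    moreover have "inner (y - z) d = inner d d"
      using dn by (subst (2) d_def) (simp add: inner_diff_left)
    ultimately show ?R
      by (metis d_def eq_iff_diff_eq_0 inner_eq_zero_iff inner_ge_zero order_antisym)
  next
    assume R: ?R
    then have yz: "inner y n \<le> inner z n" and z: "inner z n \<le> 0" by auto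
    show ?L
    proof
      fix h
      define t where "t = inner n h / (norm n)\<^sup>2"
      have "inner (y - z) h = inner (y - z) n * t"
        using R unfolding t_def by (metis inner_scaleR_left times_divide_eq_left times_divide_eq_right mult.commute)
      \<comment> \<open>For \<open>t \<le> 0\<close> this is
        \<open>inner y n \<le> inner z n\<close>, for \<open>t > 0\<close> it is
        \<open>inner z n \<le> 0\<close>, each scaled by \<open>t\<close>.\<close>
      moreover have "max 0 t * inner y n \<le> inner (y - z) n * t"
      proof (cases "t \<le> 0")
        case True
        then show ?thesis
          using yz by (simp add: inner_diff_left mult_nonpos_nonpos)
      next
        case False
        then have "t * inner z n \<le> 0"
          using z by (simp add: mult_nonneg_nonpos)
        then show ?thesis
          using False by (simp add: inner_diff_left algebra_simps)
      qed
      ultimately show "inner z h \<le> inner y (h - max 0 (inner n h / (norm n)\<^sup>2) *\<^sub>R n)"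
        unfolding t_def[symmetric] by (simp add: inner_diff_left inner_diff_right)
    qed
  }
qed

section \<open>The coderivative inside, outside and on the sphere\<close>

theorem theorem3p4:
  fixes c xbar :: "'a::{real_inner, complete_space}" and r :: real
  assumes "r > 0"
  defines "P \<equiv> metric_projection (cball c r)"
  shows "(xbar \<in> interior (cball c r) \<longrightarrow> (\<forall>y. regular_coderivative P xbar y = {y})) \<and>
    (xbar \<notin> cball c r \<longrightarrow>
      (\<forall>y. regular_coderivative P xbar y =
        {(r / norm (xbar - c)) *\<^sub>R
           (y - (inner (xbar - c) y / (norm (xbar - c))\<^sup>2) *\<^sub>R (xbar - c))})) \<and>
    (xbar \<in> frontier (cball c r) \<longrightarrow>
      (\<forall>y. regular_coderivative P xbar y =
        {z. inner y (xbar - c) \<le> inner z (xbar - c) \<and> inner z (xbar - c) \<le> 0 \<and>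
            y - z = (inner (y - z) (xbar - c) / (norm (xbar - c))\<^sup>2) *\<^sub>R (xbar - c)}))"
proof (intro conjI impI allI)
  fix y
  have P: "P u = u - max 0 (1 - r / norm (u - c)) *\<^sub>R (u - c)" for u
    using \<open>r > 0\<close> unfolding P_def by (rule metric_projection_cball)
  {
    assume x: "xbar \<in> interior (cball c r)"
    have "P u = u" if "u \<in> interior (cball c r)" for u
    proof -
      have "norm (u - c) \<le> r"
        using that interior_subset by (fastforce simp: dist_norm norm_minus_commute)
      then show ?thesis
        by (cases "u = c") (auto simp: P field_simps max_def)
    qed
    then have "(P has_derivative (\<lambda>h. h)) (at xbar)"
      using x by (intro has_derivative_transform_within_open[OF has_derivative_ident open_interior]) auto
    then show "regular_coderivative P xbar y = {y}"
      by (intro regular_coderivative_has_derivative) auto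
  next
    assume x: "xbar \<notin> cball c r"
    then have "xbar \<noteq> c"
      using \<open>r > 0\<close> by auto
    define n where "n = xbar - c"
    have n: "norm n > 0"
      using \<open>xbar \<noteq> c\<close> by (simp add: n_def)
    define D where "D h = (r / norm n) *\<^sub>R (h - (inner n h / (norm n)\<^sup>2) *\<^sub>R n)" for h
    \<comment> \<open>By the product rule the terms in \<open>h\<close> combine to
      \<open>r / norm n\<close> times \<open>h\<close>, and differentiating the shrink factor gives
      the radial correction. On the open complement of the ball the truncation is inactive, so this
      is also the derivative of \<open>P\<close>.\<close>
    have der: "((\<lambda>u. u - (1 - r / norm (u - c)) *\<^sub>R (u - c)) has_derivative D) (at xbar)"
      by (rule has_derivative_one_minus_radius_div_norm[OF \<open>xbar \<noteq> c\<close>] derivative_eq_intros refl)+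
        (use n in \<open>auto simp: fun_eq_iff D_def algebra_simps power2_eq_square power3_eq_cube simp flip: n_def\<close>)
    have eq: "u - (1 - r / norm (u - c)) *\<^sub>R (u - c) = P u" if "u \<in> - cball c r" for u
    proof -
      have "norm (u - c) > r"
        using that by (simp add: dist_norm norm_minus_commute)
      then have "max 0 (1 - r / norm (u - c)) = 1 - r / norm (u - c)"
        using \<open>r > 0\<close>
        by (subst max_absorb2) (auto simp: divide_le_eq_1)
      then show ?thesis
        by (simp only: P)
    qed
    have "(P has_derivative D) (at xbar)"
      by (rule has_derivative_transform_within_open[OF der open_Compl[OF closed_cball] _ eq]) (use x in auto)
    then have "regular_coderivative P xbar y = {D y}"
      by (rule regular_coderivative_has_derivative)
        (simp add: D_def inner_diff_left inner_diff_right inner_commute mult.commute)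
    then show "regular_coderivative P xbar y =
        {(r / norm (xbar - c)) *\<^sub>R
           (y - (inner (xbar - c) y / (norm (xbar - c))\<^sup>2) *\<^sub>R (xbar - c))}"
      by (simp add: D_def n_def)
  next
    assume x: "xbar \<in> frontier (cball c r)"
    \<comment> \<open>Frontier points avoid the interior, hence the open ball, so their distance to
      \<open>c\<close> is at least \<open>r\<close>; closedness of the ball gives the converse
      bound.\<close>
    have "ball c r \<subseteq> interior (cball c r)"
      by (rule interior_maximal) auto
    then have r: "norm (xbar - c) = r"
      using x by (force simp: frontier_def dist_norm norm_minus_commute)
    define \<phi> where "\<phi> h = h - max 0 (inner (xbar - c) h / (norm (xbar - c))\<^sup>2) *\<^sub>R (xbar - c)" for h
    have "regular_coderivative P xbar y = {z. \<forall>h. inner z h \<le> inner y (\<phi> h)}"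
    proof (rule regular_coderivative_B_differentiable)
      show "\<phi> (t *\<^sub>R h) = t *\<^sub>R \<phi> h" if "t > 0" for t h
        using that by (simp add: \<phi>_def max_mult_distrib_left algebra_simps)
      show "(\<phi> \<longlongrightarrow> 0) (at 0)"
        unfolding \<phi>_def using r \<open>r > 0\<close> by (auto intro!: tendsto_eq_intros)
      show "((\<lambda>h. norm (P (xbar + h) - P xbar - \<phi> h) / norm h) \<longlongrightarrow> 0) (at 0)"
        unfolding \<phi>_def P_def
        by (rule B_derivative_metric_projection_cball_boundary[OF \<open>r > 0\<close> r])
    qed
    moreover have nz: "xbar - c \<noteq> 0"
      using r \<open>r > 0\<close> by auto
    ultimately show "regular_coderivative P xbar y =
        {z. inner y (xbar - c) \<le> inner z (xbar - c) \<and> inner z (xbar - c) \<le> 0 \<and>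
            y - z = (inner (y - z) (xbar - c) / (norm (xbar - c))\<^sup>2) *\<^sub>R (xbar - c)}"
      by (simp only: \<phi>_def polar_of_halfspace_projection_iff[OF nz])
  }
qed

end
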